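(* Suppose that $\varepsilon^{\mathrm{op}}_h\to 0$ as $h\to 0$. Then $$\limsup_{h\to 0}\alpha(T_h)\leq \alpha(T).$$ Moreover, if the problem $Tz=0$ admits a solution $z\in E$ with $\|z\|_M=1$, and if the sequence $(T_h)_{h>0}$ satisfies the discrete inf-sup condition (there exists $\beta^*>0$ such that $\beta^*\leq\beta(T_h)$ for all $h>0$), then $$\limsup_{h\to 0}\beta(T_h)\leq \beta(T).$$
   Context: Setting. $M$ and $V$ are real Hilbert spaces; $E\subset M$ is a Banach space (with its own norm $\|\cdot\|_E$) that is dense in $M$; $V'$ is the dual of $V$ (bounded linear forms) with the operator norm; $\mathscr L(M,V')$ is the space of bounded linear operators. $T\in\mathscr L(M,V')$ is fixed. Discretization. $(M_h)_{h>0}$ and $(V_h)_{h>0}$ are families of finite-dimensional subspaces of $M$ and $V$ that approach $M$ and $V$ respectively: a family $(X_h)_{h>0}$ of subspaces of $X$ approaches $X$ if for every $x\in X$ there are $x_h\in X_h$ with $\|x_h-x\|_X\to0$ as $h\to0$. $M_h$, $V_h$ carry the norms of $M$, $V$. One has $M_h\subset E$, and $E_h$ denotes $M_h$ endowed with the $E$-norm. $\pi_h:M\to M_h$ is the orthogonal projection, and it is assumed that $\|\pi_h m\|_E\le\|m\|_E$ for all $m\in E$. $V_h'$ is the space of linear forms on $V_h$ with norm $\|f\|_{V_h'}=\sup_{v\in V_h}\langle f,v\rangle/\|v\|_V$; elements of $V'$ are regarded as elements of $V_h'$ by restriction. For each $h>0$, $T_h\in\mathscr L(M_h,V_h')$ is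 a given operator, and $$\varepsilon^{\mathrm{op}}_h:=\|T_h-T\|_{E_h,V_h'}:=\sup_{\mu\in E_h}\sup_{v\in V_h}\frac{\langle (T_h-T)\mu,v\rangle_{V_h',V_h}}{\|\mu\|_E\|v\|_V}.$$ Constants. All infima and suprema of quotients are over nonzero vectors (infimum over the empty set is $+\infty$). For $T\in\mathscr L(M,V')$, $$\alpha(T):=\inf_{\mu\in M}\sup_{v\in V}\frac{\langle T\mu,v\rangle_{V',V}}{\|\mu\|_M\|v\|_V},\qquad \beta_e(T):=\inf_{\mu\in M,\ \mu\perp e}\ \sup_{v\in V}\frac{\langle T\mu,v\rangle_{V',V}}{\|\mu\|_M\|v\|_V}\ (e\in M,\ e\ne0),\qquad \beta(T):=\sup_{e\in M,\ \|e\|_M=1}\beta_e(T).$$ $\alpha(T_h)$ and $\beta(T_h)$ are defined by the same formulas with $(T,M,V)$ replaced by $(T_h,M_h,V_h)$ (orthogonality being that of $M$). *)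

theory Defs
  imports "HOL-Analysis.Analysis"
begin

text \<open>Completeness of the subspace is with respect to the norm \<open>N\<close>, not the ambient norm;
  no continuity of the inclusion is required. Only the values of \<open>N\<close> on \<open>E\<close> matter.\<close>

definition banach_subspace :: "'a::real_vector set \<Rightarrow> ('a \<Rightarrow> real) \<Rightarrow> bool" where
  "banach_subspace E N \<longleftrightarrow>
     subspace E \<and>
     (\<forall>x\<in>E. 0 \<le> N x \<and> (N x = 0 \<longleftrightarrow> x = 0)) \<and>
     (\<forall>c. \<forall>x\<in>E. N (c *\<^sub>R x) = \<bar>c\<bar> * N x) \<and>
     (\<forall>x\<in>E. \<forall>y\<in>E. N (x + y) \<le> N x + N y) \<and>
     (\<forall>s::nat \<Rightarrow> 'a.
        (\<forall>n. s n \<in> E) \<and> (\<forall>e>0. \<exists>k. \<forall>m\<ge>k. \<forall>n\<ge>k. N (s m - s n) < e)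
        \<longrightarrow> (\<exists>l\<in>E. (\<lambda>n. N (s n - l)) \<longlonglongrightarrow> 0))"

definition findim_subspace :: "'a::real_vector set \<Rightarrow> bool" where
  "findim_subspace S \<longleftrightarrow> (\<exists>B. finite B \<and> S = span B)"

definition approaches_space :: "(real \<Rightarrow> 'a::real_normed_vector set) \<Rightarrow> bool" where
  "approaches_space X \<longleftrightarrow>
     (\<forall>x. \<exists>xh. (\<forall>h>0. xh h \<in> X h) \<and> ((\<lambda>h. norm (xh h - x)) \<longlongrightarrow> 0) (at_right 0))"

definition orth_proj :: "'a::real_inner set \<Rightarrow> 'a \<Rightarrow> 'a" where
  "orth_proj S x = (THE p. p \<in> S \<and> (\<forall>s\<in>S. orthogonal (x - p) s))"

text \<open>A bounded operator from \<open>X\<close> to the dual of \<open>Y\<close>, for subspaces \<open>X\<close> and \<open>Y\<close>, is encoded in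
  curried form: \<open>B x y\<close> is the duality pairing of \<open>B x\<close> with \<open>y\<close>, and only its values
  for \<open>x \<in> X\<close> and \<open>y \<in> Y\<close> are meaningful.\<close>

definition bounded_operator_to_dual_on ::
  "'a::real_normed_vector set \<Rightarrow> 'b::real_normed_vector set \<Rightarrow> ('a \<Rightarrow> 'b \<Rightarrow> real) \<Rightarrow> bool" where
  "bounded_operator_to_dual_on X Y B \<longleftrightarrow>
     (\<forall>x\<in>X. \<forall>y\<in>Y. \<forall>y'\<in>Y. B x (y + y') = B x y + B x y') \<and>
     (\<forall>x\<in>X. \<forall>y\<in>Y. \<forall>c. B x (c *\<^sub>R y) = c * B x y) \<and>
     (\<forall>x\<in>X. \<forall>x'\<in>X. \<forall>y\<in>Y. B (x + x') y = B x y + B x' y) \<and>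
     (\<forall>x\<in>X. \<forall>y\<in>Y. \<forall>c. B (c *\<^sub>R x) y = c * B x y) \<and>
     (\<exists>K. \<forall>x\<in>X. \<forall>y\<in>Y. \<bar>B x y\<bar> \<le> K * norm x * norm y)"

text \<open>All infima and suprema below are taken in \<open>[0, \<infinity>]\<close>, so that the infimum over the
  empty set is \<open>\<infinity>\<close> and the supremum over the empty set is \<open>0\<close> (the norm of the only form on
  the zero space). The map \<open>ennreal\<close> sends negative quotients to \<open>0\<close>; this does not affect the
  suprema over \<open>y\<close>, since the quotient changes sign under \<open>y \<mapsto> - y\<close>.\<close>

definition infsup_alpha ::
  "'a::real_inner set \<Rightarrow> 'b::real_inner set \<Rightarrow> ('a \<Rightarrow> 'b \<Rightarrow> real) \<Rightarrow> ennreal" where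
  "infsup_alpha X Y B =
     (INF x\<in>X - {0}. SUP y\<in>Y - {0}. ennreal (B x y / (norm x * norm y)))"

definition infsup_beta_at ::
  "'a::real_inner \<Rightarrow> 'a set \<Rightarrow> 'b::real_inner set \<Rightarrow> ('a \<Rightarrow> 'b \<Rightarrow> real) \<Rightarrow> ennreal" where
  "infsup_beta_at e X Y B =
     (INF x\<in>{x\<in>X. orthogonal x e} - {0}. SUP y\<in>Y - {0}. ennreal (B x y / (norm x * norm y)))"

definition infsup_beta ::
  "'a::real_inner set \<Rightarrow> 'b::real_inner set \<Rightarrow> ('a \<Rightarrow> 'b \<Rightarrow> real) \<Rightarrow> ennreal" where
  "infsup_beta X Y B = (SUP e\<in>{e\<in>X. norm e = 1}. infsup_beta_at e X Y B)"

definition operator_dist ::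
  "('a \<Rightarrow> real) \<Rightarrow> 'a::real_inner set \<Rightarrow> 'b::real_inner set \<Rightarrow>
     ('a \<Rightarrow> 'b \<Rightarrow> real) \<Rightarrow> ('a \<Rightarrow> 'b \<Rightarrow> real) \<Rightarrow> ennreal" where
  "operator_dist N X Y B C =
     (SUP x\<in>X - {0}. SUP y\<in>Y - {0}. ennreal ((B x y - C x y) / (N x * norm y)))"

end

theory Submission imports Defs begin

text \<open>For \<open>\<mu> \<in> E\<close> the projections \<open>\<pi>\<^sub>h \<mu>\<close> converge to \<open>\<mu>\<close> in \<open>M\<close> and stay bounded in \<open>E\<close>, so the
  dual norm of \<open>T\<^sub>h \<pi>\<^sub>h \<mu>\<close> is at most a quantity converging to \<open>\<parallel>T \<mu>\<parallel>\<close>. Testing \<open>\<alpha>(T\<^sub>h)\<close> with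
  \<open>\<pi>\<^sub>h \<mu>\<close> and using the density of \<open>E\<close> gives the first claim. For the second one, the plane spanned
  by \<open>\<pi>\<^sub>h z\<close> and \<open>\<pi>\<^sub>h \<mu>\<close>, where \<open>\<mu> \<in> E\<close> is orthogonal to \<open>z\<close>, meets the orthogonal complement of
  every \<open>e\<close>, as in the min-max description of the second singular value; since
  \<open>T\<^sub>h \<pi>\<^sub>h z\<close> tends to zero, this bounds \<open>limsup \<beta>(T\<^sub>h)\<close> by \<open>\<parallel>T \<mu>\<parallel> / \<parallel>\<mu>\<parallel>\<close>, hence by \<open>\<beta>\<^sub>z(T)\<close>.\<close>

section \<open>Orthogonal projection onto finite-dimensional subspaces\<close>

lemma orth_proj_exists:
  fixes x :: "'a::real_inner"
  assumes "findim_subspace S"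
  shows "\<exists>p\<in>S. \<forall>s\<in>S. orthogonal (x - p) s"
proof -
  obtain B where B: "finite B" "S = span B"
    using assms by (auto simp: findim_subspace_def)
  obtain C where C: "finite C" "span C = S" "pairwise orthogonal C"
    using basis_orthogonal[OF B(1)] B(2) by metis
  define p where "p = (\<Sum>b\<in>C. (x \<bullet> b / (b \<bullet> b)) *\<^sub>R b)"
  have "p \<in> S"
    unfolding p_def C(2)[symmetric] by (intro span_sum span_scale span_base)
  have "orthogonal (x - p) b" if "b \<in> C" for b
  proof -
    \<comment> \<open>\<open>C\<close> may contain 0; for \<open>b = 0\<close> both sides are 0,
      since division by zero yields 0.\<close>
    have "p \<bullet> b = (\<Sum>a\<in>C. if a = b then x \<bullet> b else 0)"
      unfolding p_def inner_sum_left
      using C(3) that by (intro sum.cong) (auto simp: pairwise_def orthogonal_def)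
    then show ?thesis
      using that C(1) by (simp add: orthogonal_def inner_diff_left)
  qed
  then have "\<forall>s\<in>S. orthogonal (x - p) s"
    using orthogonal_to_span C(2) by blast
  with \<open>p \<in> S\<close> show ?thesis by blast
qed

text \<open>Two candidates differ by a vector of \<open>S\<close> that is orthogonal to
  \<open>S\<close>, hence to itself, so the definite description in \<open>orth_proj\<close>
  denotes.\<close>

lemma orth_proj_works:
  fixes x :: "'a::real_inner"
  assumes "findim_subspace S"
  shows "orth_proj S x \<in> S \<and> (\<forall>s\<in>S. orthogonal (x - orth_proj S x) s)"
  unfolding orth_proj_def
proof (rule theI')
  have sub: "subspace S"
    using assms by (auto simp: findim_subspace_def)
  have "p = q" if "p \<in> S" "\<forall>s\<in>S. orthogonal (x - p) s" "q \<in> S" "\<forall>s\<in>S. orthogonal (x - q) s" for p q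
  proof -
    have "p - q \<in> S" using sub that by (simp add: subspace_diff)
    then have "(x - q) \<bullet> (p - q) - (x - p) \<bullet> (p - q) = 0"
      using that by (simp add: orthogonal_def)
    then have "(p - q) \<bullet> (p - q) = 0"
      by (simp add: inner_diff_left)
    then show ?thesis by simp
  qed
  then show "\<exists>!p. p \<in> S \<and> (\<forall>s\<in>S. orthogonal (x - p) s)"
    using orth_proj_exists[OF assms] by metis
qed

lemma norm_orth_proj_diff_le:
  fixes x :: "'a::real_inner"
  assumes "findim_subspace S" "s \<in> S"
  shows "norm (orth_proj S x - x) \<le> norm (s - x)"
proof -
  let ?p = "orth_proj S x"
  have "?p - s \<in> S"
    using assms orth_proj_works[OF assms(1)] by (auto simp: findim_subspace_def subspace_diff)
  then have "orthogonal (x - ?p) (?p - s)"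
    using orth_proj_works[OF assms(1)] by blast
  from norm_add_Pythagorean[OF this]
  have "(norm (x - ?p))\<^sup>2 \<le> (norm (x - s))\<^sup>2" by simp
  then show ?thesis
    by (simp add: norm_minus_commute)
qed

text \<open>Best approximation transfers the convergence of arbitrary approximants to the
  projections, which are the approximants with a stability bound in \<open>normE\<close>.\<close>

lemma tendsto_orth_proj:
  fixes X :: "real \<Rightarrow> 'a::real_inner set"
  assumes "approaches_space X" "\<And>h. h > 0 \<Longrightarrow> findim_subspace (X h)"
  shows "((\<lambda>h. orth_proj (X h) x) \<longlongrightarrow> x) (at_right 0)"
proof -
  obtain xh where xh: "\<And>h. h > 0 \<Longrightarrow> xh h \<in> X h" "((\<lambda>h. norm (xh h - x)) \<longlongrightarrow> 0) (at_right 0)"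
    using assms(1) unfolding approaches_space_def by metis
  have "((\<lambda>h. orth_proj (X h) x - x) \<longlongrightarrow> 0) (at_right 0)"
    using xh(2)
    by (rule Lim_null_comparison[rotated])
      (use eventually_at_right_less[of "0::real"] in eventually_elim,
       simp add: norm_orth_proj_diff_le assms(2) xh(1))
  then show ?thesis by (simp add: LIM_zero_cancel)
qed

section \<open>From suprema of quotients to linear inequalities\<close>

text \<open>Finiteness matters because \<open>enn2real\<close> sends \<open>top\<close> to 0. Zero
  vectors, which the quotients exclude, are harmless: both forms vanish there by
  homogeneity.\<close>

lemma operator_dist_bound:
  fixes C :: "'a::real_inner \<Rightarrow> 'b::real_inner \<Rightarrow> real"
  assumes fin: "operator_dist N X Y B C \<noteq> top"
    and B: "bounded_operator_to_dual_on X Y B" and C: "bounded_operator_to_dual_on X Y C"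
    and N: "\<And>x. x \<in> X \<Longrightarrow> x \<noteq> 0 \<Longrightarrow> N x > 0" "N 0 = 0"
    and x: "x \<in> X" and y: "y \<in> Y"
  shows "B x y \<le> C x y + enn2real (operator_dist N X Y B C) * N x * norm y"
proof -
  have zero: "D x y = 0" if "bounded_operator_to_dual_on X Y D" "x = 0 \<or> y = 0" for D
  proof -
    have "D (0 *\<^sub>R x) y = 0 * D x y" "D x (0 *\<^sub>R y) = 0 * D x y"
      using that(1) x y unfolding bounded_operator_to_dual_on_def by blast+
    then show ?thesis using that(2) by auto
  qed
  show ?thesis
  proof (cases "x = 0 \<or> y = 0")
    case True
    then show ?thesis
      using zero[OF B] zero[OF C] N(2) by auto
  next
    case False
    have "ennreal ((B x y - C x y) / (N x * norm y)) \<le> operator_dist N X Y B C"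
      unfolding operator_dist_def using False x y by (intro SUP_upper2[of x] SUP_upper) auto
    also have "\<dots> = ennreal (enn2real (operator_dist N X Y B C))"
      using fin by (simp add: less_top)
    finally have "(B x y - C x y) / (N x * norm y) \<le> enn2real (operator_dist N X Y B C)"
      by simp
    then show ?thesis
      using False N(1)[OF x] by (simp add: field_simps)
  qed
qed

lemma bounded_operator_to_dual_on_blinfun:
  fixes T :: "'a::real_normed_vector \<Rightarrow>\<^sub>L ('b::real_normed_vector \<Rightarrow>\<^sub>L real)"
  shows "bounded_operator_to_dual_on X Y (\<lambda>x. blinfun_apply (blinfun_apply T x))"
proof -
  have "\<bar>T x y\<bar> \<le> norm T * norm x * norm y" for x y
    using norm_blinfun[of "T x" y] mult_right_mono[OF norm_blinfun[of T x] norm_ge_zero[of y]]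
    by simp
  then show ?thesis
    unfolding bounded_operator_to_dual_on_def
    by (auto simp: blinfun.add_left blinfun.add_right blinfun.scaleR_left blinfun.scaleR_right)
qed

text \<open>A single test vector bounds the infimum. The set \<open>S\<close> is left free so that
  it can be all of \<open>X\<close> for alpha or the part of \<open>X\<close> orthogonal to
  \<open>e\<close> for beta.\<close>

lemma INF_quotient_le:
  fixes B :: "'a::real_inner \<Rightarrow> 'b::real_inner \<Rightarrow> real"
  assumes "x \<in> S" "x \<noteq> 0" "\<And>y. y \<in> Y \<Longrightarrow> B x y \<le> c * norm x * norm y"
  shows "(INF x\<in>S - {0}. SUP y\<in>Y - {0}. ennreal (B x y / (norm x * norm y))) \<le> ennreal c"
  using assms by (intro INF_lower2[of x] SUP_least ennreal_leI) (auto simp: field_simps)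

text \<open>Replaces the supremum by a strict inequality between norms, an open condition to which
  density applies. Testing with \<open>y\<close> and \<open>- y\<close> recovers the absolute value
  that \<open>ennreal\<close> truncates.\<close>

lemma dual_norm_less:
  fixes F :: "'b::real_normed_vector \<Rightarrow>\<^sub>L real"
  assumes "(SUP y\<in>UNIV - {0}. ennreal (F y / (a * norm y))) < ennreal c" "a > 0"
  shows "norm F < c * a"
proof -
  obtain k where k: "(SUP y\<in>UNIV - {0}. ennreal (F y / (a * norm y))) = ennreal k" "0 \<le> k" "k < c"
    using assms(1) by (cases "SUP y\<in>UNIV - {0}. ennreal (F y / (a * norm y))")
      (auto simp: ennreal_less_iff)
  have le: "F y \<le> k * a * norm y" for y
  proof (cases "y = 0")
    case False
    then have "ennreal (F y / (a * norm y)) \<le> ennreal k"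
      unfolding k(1)[symmetric] by (intro SUP_upper) auto
    then show ?thesis
      using False k(2) assms(2) by (simp add: field_simps)
  qed simp
  have "norm (F y) \<le> k * a * norm y" for y
    using le[of y] le[of "- y"] by (simp add: blinfun.minus_right abs_le_iff)
  then have "norm F \<le> k * a"
    using k(2) assms(2) by (intro norm_blinfun_bound) auto
  also have "\<dots> < c * a"
    using k(3) assms(2) by simp
  finally show ?thesis .
qed

text \<open>Lets the limit arguments run with a real constant \<open>c\<close> strictly above the
  target; an infinite target is trivial.\<close>

lemma ennreal_le_by_real_bounds:
  fixes K L :: ennreal
  assumes "\<And>c. K < ennreal c \<Longrightarrow> L \<le> ennreal c"
  shows "L \<le> K"
proof (cases K)
  case (real k)
  have "L \<le> K + ennreal e" if "e > 0" for e
  proof -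
    have "K + ennreal e = ennreal (k + e)" using real that by simp
    moreover have "K < ennreal (k + e)"
      using real that by (simp add: ennreal_less_iff)
    ultimately show ?thesis using assms[of "k + e"] by simp
  qed
  then show ?thesis by (rule ennreal_le_epsilon)
qed simp

section \<open>Two-dimensional test spaces\<close>

text \<open>Meant for nearly orthogonal \<open>z\<close> and \<open>u\<close>. The cross term of the
  squared norm of \<open>a z + b u\<close> is absorbed using 2|ab| \<le> a^2 + b^2, which costs |z .
  u| in each squared norm and leaves the weights \<open>Z\<close> and \<open>U\<close>. A weighted
  Cauchy-Schwarz inequality then gives the first claim.\<close>

lemma plane_norm_bound:
  fixes z u :: "'a::real_inner"
  defines "Z \<equiv> (norm z)\<^sup>2 - \<bar>z \<bullet> u\<bar>" and "U \<equiv> (norm u)\<^sup>2 - \<bar>z \<bullet> u\<bar>"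
  assumes pos: "Z > 0" "U > 0" and c: "c > 0" "p\<^sup>2 / Z + q\<^sup>2 / U \<le> c\<^sup>2"
  shows "\<bar>a\<bar> * p + \<bar>b\<bar> * q \<le> c * norm (a *\<^sub>R z + b *\<^sub>R u)"
    and "a *\<^sub>R z + b *\<^sub>R u = 0 \<Longrightarrow> a = 0 \<and> b = 0"
proof -
  let ?w = "a *\<^sub>R z + b *\<^sub>R u"
  have "2 * \<bar>a\<bar> * \<bar>b\<bar> \<le> a\<^sup>2 + b\<^sup>2"
    using sum_squares_bound[of "\<bar>a\<bar>" "\<bar>b\<bar>"] by simp
  then have "2 * \<bar>a\<bar> * \<bar>b\<bar> * \<bar>z \<bullet> u\<bar> \<le> (a\<^sup>2 + b\<^sup>2) * \<bar>z \<bullet> u\<bar>"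
    by (intro mult_right_mono) auto
  moreover have "\<bar>2 * a * b * (z \<bullet> u)\<bar> = 2 * \<bar>a\<bar> * \<bar>b\<bar> * \<bar>z \<bullet> u\<bar>"
    by (simp add: abs_mult)
  ultimately have "0 \<le> (a\<^sup>2 + b\<^sup>2) * \<bar>z \<bullet> u\<bar> + 2 * a * b * (z \<bullet> u)"
    by linarith
  moreover have "(norm ?w)\<^sup>2 = a\<^sup>2 * (norm z)\<^sup>2 + 2 * a * b * (z \<bullet> u) + b\<^sup>2 * (norm u)\<^sup>2"
    unfolding power2_norm_eq_inner
    by (simp add: inner_commute power2_eq_square algebra_simps)
  ultimately have w: "a\<^sup>2 * Z + b\<^sup>2 * U \<le> (norm ?w)\<^sup>2"
    unfolding Z_def U_def by (simp add: algebra_simps)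
  show "a = 0 \<and> b = 0" if "?w = 0"
  proof -
    have "a\<^sup>2 * Z + b\<^sup>2 * U \<le> 0" using w that by simp
    moreover have "a\<^sup>2 * Z \<ge> 0" "b\<^sup>2 * U \<ge> 0" using pos by auto
    ultimately have "a\<^sup>2 * Z = 0" "b\<^sup>2 * U = 0" by linarith+
    then show ?thesis using pos by auto
  qed
  have "(\<bar>a\<bar> * p + \<bar>b\<bar> * q)\<^sup>2 \<le> (a\<^sup>2 * Z + b\<^sup>2 * U) * (p\<^sup>2 / Z + q\<^sup>2 / U)"
  proof -
    \<comment> \<open>Lagrange's identity: the defect in Cauchy-Schwarz is a square over
      \<open>Z * U\<close>.\<close>
    have "(a\<^sup>2 * Z + b\<^sup>2 * U) * (p\<^sup>2 / Z + q\<^sup>2 / U) - (\<bar>a\<bar> * p + \<bar>b\<bar> * q)\<^sup>2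
        = (\<bar>a\<bar> * Z * q - \<bar>b\<bar> * U * p)\<^sup>2 / (Z * U)"
    proof -
      have "\<bar>a\<bar>\<^sup>2 = a\<^sup>2" "\<bar>b\<bar>\<^sup>2 = b\<^sup>2" by simp_all
      then show ?thesis
        using pos
        by (simp only: power2_eq_square) (simp add: field_simps)
    qed
    moreover have "\<dots> \<ge> 0" using pos by simp
    ultimately show ?thesis by linarith
  qed
  also have "\<dots> \<le> (norm ?w)\<^sup>2 * c\<^sup>2"
    using w c(2) pos by (intro mult_mono) auto
  also have "\<dots> = (c * norm ?w)\<^sup>2"
    by (simp add: power_mult_distrib)
  finally show "\<bar>a\<bar> * p + \<bar>b\<bar> * q \<le> c * norm ?w"
    by (rule power2_le_imp_le) (use c(1) in simp)
qed

text \<open>For each \<open>e\<close> some nonzero vector of the plane spanned by \<open>z\<close>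
  and \<open>u\<close> is orthogonal to \<open>e\<close> and can serve as test vector. The resulting
  bound \<open>c\<close> does not depend on \<open>e\<close>, so it survives the supremum.\<close>

lemma infsup_beta_le_plane:
  fixes X :: "'a::real_inner set" and Y :: "'b::real_inner set"
  assumes B: "bounded_operator_to_dual_on X Y B" and X: "subspace X" and Y: "subspace Y"
    and z: "z \<in> X" and u: "u \<in> X"
    and p: "\<And>y. y \<in> Y \<Longrightarrow> B z y \<le> p * norm y" and q: "\<And>y. y \<in> Y \<Longrightarrow> B u y \<le> q * norm y"
    and pos: "(norm z)\<^sup>2 - \<bar>z \<bullet> u\<bar> > 0" "(norm u)\<^sup>2 - \<bar>z \<bullet> u\<bar> > 0"
    and c: "c > 0" "p\<^sup>2 / ((norm z)\<^sup>2 - \<bar>z \<bullet> u\<bar>) + q\<^sup>2 / ((norm u)\<^sup>2 - \<bar>z \<bullet> u\<bar>) \<le> c\<^sup>2"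
  shows "infsup_beta X Y B \<le> ennreal c"
  unfolding infsup_beta_def
proof (rule SUP_least)
  fix e
  \<comment> \<open>One linear equation in two unknowns: \<open>z\<close> itself if it is orthogonal
    to \<open>e\<close>, otherwise (u . e) z - (z . e) u, whose second coefficient is
    nonzero.\<close>
  obtain a b where ab: "a \<noteq> 0 \<or> b \<noteq> 0" "a * (z \<bullet> e) + b * (u \<bullet> e) = 0"
  proof (cases "z \<bullet> e = 0")
    case True
    then show ?thesis using that[of 1 0] by simp
  next
    case False
    then show ?thesis using that[of "u \<bullet> e" "- (z \<bullet> e)"] by simp
  qed
  let ?w = "a *\<^sub>R z + b *\<^sub>R u"
  \<comment> \<open>The hypotheses are one-sided, so the sign of \<open>t\<close> is moved into the
    test vector.\<close>
  have ab_bound: "t * B x y \<le> \<bar>t\<bar> * r * norm y"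
    if "x \<in> X" "y \<in> Y" "\<And>y. y \<in> Y \<Longrightarrow> B x y \<le> r * norm y" for t x y r
  proof -
    have "B x (t *\<^sub>R y) = t * B x y"
      using B that(1,2) unfolding bounded_operator_to_dual_on_def by blast
    then show ?thesis
      using that(3)[of "t *\<^sub>R y"] that(2) Y by (simp add: subspace_scale mult_ac)
  qed
  show "infsup_beta_at e X Y B \<le> ennreal c"
    unfolding infsup_beta_at_def
  proof (rule INF_quotient_le)
    show "?w \<in> {x \<in> X. orthogonal x e}"
      using X z u ab(2) by (simp add: subspace_add subspace_scale orthogonal_def inner_add_left)
    show "?w \<noteq> 0"
      using plane_norm_bound(2)[OF pos c] ab(1) by blast
    fix y assume y: "y \<in> Y"
    have "B ?w y = B (a *\<^sub>R z) y + B (b *\<^sub>R u) y"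
      "B (a *\<^sub>R z) y = a * B z y" "B (b *\<^sub>R u) y = b * B u y"
      using B X y z u unfolding bounded_operator_to_dual_on_def by (metis subspace_scale, blast+)
    then have "B ?w y = a * B z y + b * B u y" by simp
    also have "\<dots> \<le> (\<bar>a\<bar> * p + \<bar>b\<bar> * q) * norm y"
      using ab_bound[OF z y p, of a] ab_bound[OF u y q, of b] by (simp add: algebra_simps)
    also have "\<dots> \<le> c * norm ?w * norm y"
      using plane_norm_bound(1)[OF pos c] by (intro mult_right_mono) auto
    finally show "B ?w y \<le> c * norm ?w * norm y" .
  qed
qed

section \<open>Passage to the limit along the projections\<close>

theorem theorem1:
  fixes T :: "'m::{real_inner, complete_space} \<Rightarrow>\<^sub>L ('v::{real_inner, complete_space} \<Rightarrow>\<^sub>L real)"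
    and E :: "'m set" and normE :: "'m \<Rightarrow> real"
    and Mh :: "real \<Rightarrow> 'm set" and Vh :: "real \<Rightarrow> 'v set"
    and Th :: "real \<Rightarrow> 'm \<Rightarrow> 'v \<Rightarrow> real"
  assumes "banach_subspace E normE" and "closure E = UNIV"
    and "\<And>h. h > 0 \<Longrightarrow> findim_subspace (Mh h)"
    and "\<And>h. h > 0 \<Longrightarrow> findim_subspace (Vh h)"
    and "approaches_space Mh" and "approaches_space Vh"
    and "\<And>h. h > 0 \<Longrightarrow> Mh h \<subseteq> E"
    and "\<And>h m. h > 0 \<Longrightarrow> m \<in> E \<Longrightarrow> normE (orth_proj (Mh h) m) \<le> normE m"
    and "\<And>h. h > 0 \<Longrightarrow> bounded_operator_to_dual_on (Mh h) (Vh h) (Th h)"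
    and "((\<lambda>h. operator_dist normE (Mh h) (Vh h) (Th h) (\<lambda>\<mu>. blinfun_apply (blinfun_apply T \<mu>)))
           \<longlongrightarrow> 0) (at_right 0)"
  shows "Limsup (at_right 0) (\<lambda>h. infsup_alpha (Mh h) (Vh h) (Th h))
           \<le> infsup_alpha UNIV UNIV (\<lambda>\<mu>. blinfun_apply (blinfun_apply T \<mu>))
       \<and> ((\<exists>z\<in>E. norm z = 1 \<and> blinfun_apply T z = 0) \<longrightarrow>
          (\<exists>b>0::real. \<forall>h>0. ennreal b \<le> infsup_beta (Mh h) (Vh h) (Th h)) \<longrightarrow>
          Limsup (at_right 0) (\<lambda>h. infsup_beta (Mh h) (Vh h) (Th h))
            \<le> infsup_beta UNIV UNIV (\<lambda>\<mu>. blinfun_apply (blinfun_apply T \<mu>)))"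
proof -
  let ?D = "\<lambda>h. operator_dist normE (Mh h) (Vh h) (Th h) (\<lambda>\<mu>. blinfun_apply (blinfun_apply T \<mu>))"
  let ?\<pi> = "\<lambda>h. orth_proj (Mh h)"
  \<comment> \<open>A bound for the dual norm of \<open>Th h\<close> at the projection of
    \<open>\<mu>\<close>: the part due to \<open>T\<close> plus the consistency error. By stability
    of the projection the latter carries the fixed factor \<open>normE \<mu>\<close>, so it tends to
    0.\<close>
  define g where "g \<mu> h = norm (T (?\<pi> h \<mu>)) + enn2real (?D h) * normE \<mu>" for \<mu> h
  have E: "subspace E" "\<And>x. x \<in> E \<Longrightarrow> normE x \<ge> 0" "\<And>x. x \<in> E \<Longrightarrow> normE x = 0 \<longleftrightarrow> x = 0"
    using assms(1) by (auto simp: banach_subspace_def)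
  have N0: "normE 0 = 0"
    using E(3) subspace_0[OF E(1)] by blast
  have sub: "subspace (Mh h)" "subspace (Vh h)" if "h > 0" for h
    using assms(3,4)[OF that] by (auto simp: findim_subspace_def)
  have proj: "?\<pi> h x \<in> Mh h" if "h > 0" for h x
    using orth_proj_works[OF assms(3)[OF that]] by blast
  have proj_lim: "((\<lambda>h. ?\<pi> h x) \<longlongrightarrow> x) (at_right 0)" for x
    using assms(3,5) by (rule tendsto_orth_proj[rotated])
  have D_lim: "((\<lambda>h. enn2real (?D h)) \<longlongrightarrow> 0) (at_right 0)"
    using tendsto_enn2real[OF assms(10)[folded ennreal_0]] by simp
  have D_fin: "\<forall>\<^sub>F h in at_right 0. ?D h \<noteq> top"
    using order_tendstoD(2)[OF assms(10) zero_less_one] by eventually_elim auto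
  have g_lim: "(g \<mu> \<longlongrightarrow> norm (T \<mu>)) (at_right 0)" for \<mu>
  proof -
    have "((\<lambda>h. norm (T (?\<pi> h \<mu>)) + enn2real (?D h) * normE \<mu>) \<longlongrightarrow> norm (T \<mu>) + 0 * normE \<mu>) (at_right 0)"
      by (intro tendsto_intros proj_lim D_lim)
    then show ?thesis by (simp add: g_def[abs_def])
  qed
  have g_bound: "\<forall>\<^sub>F h in at_right 0. h > 0 \<and> (\<forall>y\<in>Vh h. Th h (?\<pi> h \<mu>) y \<le> g \<mu> h * norm y)"
    if \<mu>: "\<mu> \<in> E" for \<mu>
    using D_fin eventually_at_right_less[of "0::real"]
  proof eventually_elim
    case (elim h)
    have "Th h (?\<pi> h \<mu>) y \<le> g \<mu> h * norm y" if y: "y \<in> Vh h" for y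
    proof -
      have "Th h (?\<pi> h \<mu>) y \<le> T (?\<pi> h \<mu>) y + enn2real (?D h) * normE (?\<pi> h \<mu>) * norm y"
      proof (rule operator_dist_bound[OF elim(1) assms(9) bounded_operator_to_dual_on_blinfun])
        show "normE x > 0" if "x \<in> Mh h" "x \<noteq> 0" for x
          using that assms(7)[OF elim(2)] E(2,3)[of x] by force
      qed (use elim proj y N0 in auto)
      also have "T (?\<pi> h \<mu>) y \<le> norm (T (?\<pi> h \<mu>)) * norm y"
        using norm_blinfun[of "T (?\<pi> h \<mu>)" y] by simp
      also have "enn2real (?D h) * normE (?\<pi> h \<mu>) * norm y \<le> enn2real (?D h) * normE \<mu> * norm y"
        using assms(8)[OF elim(2) \<mu>] by (intro mult_right_mono mult_left_mono) auto
      finally show ?thesis by (simp add: g_def algebra_simps)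
    qed
    with elim(2) show ?case by blast
  qed
  \<comment> \<open>A strict inequality between continuous functions that holds somewhere in M also
    holds at a point of E.\<close>
  have dense: "\<exists>\<nu>\<in>E. P \<nu>" if "open {\<nu>. P \<nu>}" "P \<mu>" for P :: "'m \<Rightarrow> bool" and \<mu>
    using that assms(2) open_Int_closure_eq_empty[of "{\<nu>. P \<nu>}" E] by auto

  \<comment> \<open>The bound for alpha\<close>
  have "Limsup (at_right 0) (\<lambda>h. infsup_alpha (Mh h) (Vh h) (Th h))
           \<le> infsup_alpha UNIV UNIV (\<lambda>\<mu>. blinfun_apply (blinfun_apply T \<mu>))"
    unfolding infsup_alpha_def[of UNIV]
  proof (rule INF_greatest, rule ennreal_le_by_real_bounds)
    fix \<mu> c
    assume "\<mu> \<in> UNIV - {0::'m}"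
      and "(SUP y\<in>UNIV - {0}. ennreal (T \<mu> y / (norm \<mu> * norm y))) < ennreal c"
    then have "norm (T \<mu>) < c * norm \<mu>"
      by (intro dual_norm_less) auto
    moreover have "open {\<nu>. norm (T \<nu>) < c * norm \<nu>}"
      by (intro open_Collect_less continuous_intros)
    ultimately obtain \<nu> where \<nu>: "\<nu> \<in> E" "norm (T \<nu>) < c * norm \<nu>"
      using dense by blast
    have "((\<lambda>h. c * norm (?\<pi> h \<nu>) - g \<nu> h) \<longlongrightarrow> c * norm \<nu> - norm (T \<nu>)) (at_right 0)"
      by (intro tendsto_intros proj_lim g_lim)
    then have "\<forall>\<^sub>F h in at_right 0. c * norm (?\<pi> h \<nu>) - g \<nu> h > 0"
      using \<nu>(2) by (intro order_tendstoD(1)) auto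
    moreover have "\<nu> \<noteq> 0"
      using \<nu>(2) by auto
    then have "\<forall>\<^sub>F h in at_right 0. ?\<pi> h \<nu> \<noteq> 0"
      using proj_lim by (rule tendsto_imp_eventually_ne[rotated])
    ultimately have "\<forall>\<^sub>F h in at_right 0. infsup_alpha (Mh h) (Vh h) (Th h) \<le> ennreal c"
      using g_bound[OF \<nu>(1)]
    proof eventually_elim
      case (elim h)
      show ?case
        unfolding infsup_alpha_def
      proof (rule INF_quotient_le)
        fix y assume "y \<in> Vh h"
        then have "Th h (?\<pi> h \<nu>) y \<le> g \<nu> h * norm y" using elim by blast
        also have "\<dots> \<le> c * norm (?\<pi> h \<nu>) * norm y"
          using elim by (intro mult_right_mono) auto
        finally show "Th h (?\<pi> h \<nu>) y \<le> c * norm (?\<pi> h \<nu>) * norm y" .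
      qed (use elim proj in auto)
    qed
    then show "Limsup (at_right 0) (\<lambda>h. infsup_alpha (Mh h) (Vh h) (Th h)) \<le> ennreal c"
      by (rule Limsup_bounded)
  qed

  \<comment> \<open>The bound for beta\<close>
  moreover have "Limsup (at_right 0) (\<lambda>h. infsup_beta (Mh h) (Vh h) (Th h))
           \<le> infsup_beta UNIV UNIV (\<lambda>\<mu>. blinfun_apply (blinfun_apply T \<mu>))"
    if z: "z \<in> E" "norm z = 1" "T z = 0" for z
  proof -
    \<comment> \<open>Since beta(T) is a supremum over unit vectors, the single choice
      \<open>e = z\<close> suffices.\<close>
    have "Limsup (at_right 0) (\<lambda>h. infsup_beta (Mh h) (Vh h) (Th h))
           \<le> infsup_beta_at z UNIV UNIV (\<lambda>\<mu>. blinfun_apply (blinfun_apply T \<mu>))"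
      unfolding infsup_beta_at_def
    proof (rule INF_greatest, rule ennreal_le_by_real_bounds)
      fix \<mu> c
      assume \<mu>: "\<mu> \<in> {x \<in> UNIV. orthogonal x z} - {0}"
        and "(SUP y\<in>UNIV - {0}. ennreal (T \<mu> y / (norm \<mu> * norm y))) < ennreal c"
      then have "norm (T \<mu>) < c * norm \<mu>"
        by (intro dual_norm_less) auto
      \<comment> \<open>A vector of E close to \<open>\<mu>\<close> need not be orthogonal to
        \<open>z\<close>. \<open>P\<close> restores orthogonality, fixes \<open>\<mu>\<close>, is
        continuous, and keeps E invariant because \<open>z\<close> lies in E.\<close>
      moreover define P where "P \<nu> = \<nu> - (\<nu> \<bullet> z) *\<^sub>R z" for \<nu>
      moreover have "P \<mu> = \<mu>"
        using \<mu> by (simp add: P_def orthogonal_def)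
      moreover have "open {\<nu>. norm (T (P \<nu>)) < c * norm (P \<nu>)}"
        unfolding P_def by (intro open_Collect_less continuous_intros)
      ultimately obtain \<nu> where \<nu>: "\<nu> \<in> E" "norm (T (P \<nu>)) < c * norm (P \<nu>)"
        using dense[of "\<lambda>\<nu>. norm (T (P \<nu>)) < c * norm (P \<nu>)" \<mu>] by auto
      define u where "u = P \<nu>"
      have u: "u \<in> E" "norm (T u) < c * norm u"
        using \<nu> z E(1) by (simp_all add: u_def P_def subspace_diff subspace_scale)
      have "z \<bullet> u = 0"
        using z(2) by (simp add: u_def P_def inner_diff_right inner_commute norm_eq_1)
      have "u \<noteq> 0"
        using u(2) by auto
      have "c > 0"
        using le_less_trans[OF norm_ge_zero u(2)] by (simp add: zero_less_mult_iff)
      \<comment> \<open>Projecting may destroy the orthogonality of \<open>z\<close> and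
        \<open>u\<close>, but the inner product of the projections tends to 0, so \<open>?Z\<close>
        and \<open>?U\<close> have positive limits.\<close>
      let ?s = "\<lambda>h. \<bar>?\<pi> h z \<bullet> ?\<pi> h u\<bar>"
      let ?Z = "\<lambda>h. (norm (?\<pi> h z))\<^sup>2 - ?s h" and ?U = "\<lambda>h. (norm (?\<pi> h u))\<^sup>2 - ?s h"
      have "(?Z \<longlongrightarrow> (norm z)\<^sup>2 - \<bar>z \<bullet> u\<bar>) (at_right 0)" "(?U \<longlongrightarrow> (norm u)\<^sup>2 - \<bar>z \<bullet> u\<bar>) (at_right 0)"
        by (intro tendsto_intros proj_lim)+
      then have Z: "(?Z \<longlongrightarrow> 1) (at_right 0)" and U: "(?U \<longlongrightarrow> (norm u)\<^sup>2) (at_right 0)"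
        using \<open>z \<bullet> u = 0\<close> z(2) by simp_all
      \<comment> \<open>As T z = 0, the limit is the square of the quotient of the norms of T u and
        u, hence below c^2; this gives the plane criterion with constant \<open>c\<close> for all
        small \<open>h\<close>.\<close>
      have "((\<lambda>h. (g z h)\<^sup>2 / ?Z h + (g u h)\<^sup>2 / ?U h) \<longlongrightarrow>
          (norm (T z))\<^sup>2 / 1 + (norm (T u))\<^sup>2 / (norm u)\<^sup>2) (at_right 0)"
        using \<open>u \<noteq> 0\<close> by (intro tendsto_intros Z U g_lim) auto
      moreover have "(norm (T z))\<^sup>2 / 1 + (norm (T u))\<^sup>2 / (norm u)\<^sup>2 < c\<^sup>2"
      proof -
        have "(norm (T u))\<^sup>2 < (c * norm u)\<^sup>2"
          using u(2) by (intro power_strict_mono) auto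
        then show ?thesis
          using \<open>u \<noteq> 0\<close> z(3) by (simp add: field_simps)
      qed
      ultimately have "\<forall>\<^sub>F h in at_right 0. (g z h)\<^sup>2 / ?Z h + (g u h)\<^sup>2 / ?U h < c\<^sup>2"
        by (rule order_tendstoD(2))
      moreover have "\<forall>\<^sub>F h in at_right 0. ?Z h > 0" "\<forall>\<^sub>F h in at_right 0. ?U h > 0"
        using \<open>u \<noteq> 0\<close> by (intro order_tendstoD(1)[OF Z] order_tendstoD(1)[OF U]; simp)+
      ultimately have "\<forall>\<^sub>F h in at_right 0. infsup_beta (Mh h) (Vh h) (Th h) \<le> ennreal c"
        using g_bound[OF z(1)] g_bound[OF u(1)]
      proof eventually_elim
        case (elim h)
        then show ?case
          using infsup_beta_le_plane[OF assms(9) sub proj[of h z] proj[of h u],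
              where p = "g z h" and q = "g u h"] \<open>c > 0\<close>
          by simp
      qed
      then show "Limsup (at_right 0) (\<lambda>h. infsup_beta (Mh h) (Vh h) (Th h)) \<le> ennreal c"
        by (rule Limsup_bounded)
    qed
    also have "\<dots> \<le> infsup_beta UNIV UNIV (\<lambda>\<mu>. blinfun_apply (blinfun_apply T \<mu>))"
      unfolding infsup_beta_def using z(2) by (intro SUP_upper) auto
    finally show ?thesis .
  qed
  ultimately show ?thesis by blast
qed

end
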